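(* Let $c\ge 1$ be a real number, let $n\ge 2$ and $d\geq 1$ be integers, and let $P=(p_1,\dots,p_n)$ be a $c$-chain with $n$ vertices in $\mathbb{R}^d$, with $p_1\neq p_n$. Then its stretch factor satisfies $$\delta_P\le c\,(n-2)+1.$$
   Context: A polygonal chain $P=(p_1,\dots,p_n)$ in $\mathbb{R}^d$ is specified by a sequence of $n$ points $p_1,\dots,p_n$, called its vertices; it consists of the $n-1$ line segments between consecutive vertices. $|pq|$ denotes the Euclidean distance between $p$ and $q$. For a real number $c\ge 1$, $P$ is called a $c$-chain if $|p_ip_j|+|p_jp_k|\le c\,|p_ip_k|$ for all $1\le i<j<k\le n$. The stretch factor of $P$ is $$\delta_P=\frac{\sum_{i=1}^{n-1}|p_ip_{i+1}|}{|p_1p_n|}.$$ *)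

theory Defs
  imports "HOL-Analysis.Analysis"
begin

(* A polygonal chain (p_1, ..., p_n) is the list of its vertices; p_i is P ! (i - 1). *)

definition c_chain :: "real \<Rightarrow> (real ^ 'd) list \<Rightarrow> bool" where
  "c_chain c P \<longleftrightarrow>
     (\<forall>i j k. i < j \<and> j < k \<and> k < length P \<longrightarrow>
        dist (P ! i) (P ! j) + dist (P ! j) (P ! k) \<le> c * dist (P ! i) (P ! k))"

(* Division by zero yields 0 when the end vertices coincide,
   so the value is meaningful only if hd P \<noteq> last P. *)
definition stretch_factor :: "(real ^ 'd) list \<Rightarrow> real" where
  "stretch_factor P =
     (\<Sum>i<length P - 1. dist (P ! i) (P ! Suc i)) / dist (hd P) (last P)"

end

theory Submission
  imports Defs
begin

text \<open>Let \<open>s x\<close> be the sum of the distances from \<open>x\<close> to the two ends of the chain. Averaging the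
  triangle inequalities through either end bounds every edge \<open>xy\<close> by \<open>(s x + s y) / 2\<close>. Summed
  over all edges, each of the \<open>n - 2\<close> inner vertices contributes once and is at most \<open>c D\<close> by the
  chain condition, where \<open>D\<close> is the distance of the ends; the ends contribute \<open>D / 2\<close> each.\<close>

lemma dist_le_average_via:
  fixes a b x y :: "'a::metric_space"
  shows "dist x y \<le> ((dist a x + dist x b) + (dist a y + dist y b)) / 2"
  using dist_triangle[of x y a] dist_triangle[of x y b] by (simp add: dist_commute)

text \<open>Each inner index lies in two adjacent pairs and so collects two halves; the two extreme
  indices collect one half each.\<close>

lemma sum_adjacent_averages:
  fixes s :: "nat \<Rightarrow> real"
  shows "(\<Sum>i<Suc k. (s i + s (Suc i)) / 2) = (s 0 + s (Suc k)) / 2 + (\<Sum>i=1..k. s i)"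
  by (induction k) (auto simp: field_simps)

theorem theorem2:
  fixes c :: real and n :: nat and P :: "(real ^ 'd) list"
  assumes "c \<ge> 1"
    and "n \<ge> 2"
    and "length P = n"
    and "c_chain c P"
    and "hd P \<noteq> last P"
  shows "stretch_factor P \<le> c * (real n - 2) + 1"
proof -
  obtain k where n: "n = k + 2"
    using \<open>n \<ge> 2\<close> by (metis add.commute le_Suc_ex)
  have len: "length P = k + 2" using assms n by simp
  then have "P \<noteq> []" by auto
  then have hd: "hd P = P ! 0" and last: "last P = P ! Suc k"
    using len by (simp_all add: hd_conv_nth last_conv_nth)
  define D where "D = dist (hd P) (last P)"
  define s where "s i = dist (hd P) (P ! i) + dist (P ! i) (last P)" for i
  \<comment> \<open>The chain condition for the index triple \<open>0 < i < Suc k\<close>.\<close>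
  have inner: "s i \<le> c * D" if "i \<in> {1..k}" for i
    using \<open>c_chain c P\<close> that len unfolding c_chain_def s_def D_def hd last by auto
  have "(\<Sum>i<length P - 1. dist (P ! i) (P ! Suc i)) \<le> (\<Sum>i<Suc k. (s i + s (Suc i)) / 2)"
    unfolding s_def len by (simp only: add_2_eq_Suc' diff_Suc_1)
      (intro sum_mono dist_le_average_via)
  \<comment> \<open>At either end one of the two distances in \<open>s\<close> vanishes, so
    \<open>s 0 = s (Suc k) = D\<close>.\<close>
  also have "\<dots> = D + (\<Sum>i=1..k. s i)"
    unfolding sum_adjacent_averages by (simp add: s_def D_def hd last)
  also have "\<dots> \<le> D + real k * (c * D)"
    using sum_bounded_above[of "{1..k}" s "c * D"] inner by simp
  also have "\<dots> = (c * (real n - 2) + 1) * D"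
    by (simp add: n algebra_simps)
  \<comment> \<open>Distinct ends give \<open>D > 0\<close>, which permits dividing by
    \<open>D\<close>.\<close>
  finally show ?thesis
    using \<open>hd P \<noteq> last P\<close> by (simp add: stretch_factor_def D_def divide_le_eq)
qed

end
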